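(* Let $\mathscr{G}=(\mathscr{V},\mathscr{E})$ be a graph with $\mathscr{V}$ infinite and let $q:\mathscr{V}\to[0,\infty)$. (a) If $\alpha_\infty>0$, then $(\mathscr{G},q)$ is $(a,k)$-sparse for some $a>0$, $k\ge0$. On the other hand, if $(\mathscr{G},q)$ is $(a,k)$-sparse for some $a>0$, $k\ge0$ and $$l:=\liminf_{|x|\to\infty}(\deg+q)(x)>k,$$ then $$\alpha_\infty\ge\frac{l-k}{l(a+1)}>0$$ if $l$ is finite, and $\alpha_\infty\ge1/(1+a)$ otherwise. (b) If $\alpha_\infty=1$, then $(\mathscr{G},q)$ is almost sparse. On the other hand, if $(\mathscr{G},q)$ is almost sparse and $\liminf_{|x|\to\infty}(\deg+q)(x)=\infty$, then $\alpha_\infty=1$.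
   Context: A graph $\mathscr{G}=(\mathscr{V},\mathscr{E})$ consists of a countable vertex set $\mathscr{V}$ and a symmetric function $\mathscr{E}:\mathscr{V}\times\mathscr{V}\to\{0,1\}$ with zero diagonal; $x\sim y$ means $\mathscr{E}(x,y)=1$. Graphs are locally finite: every vertex has finitely many neighbors; $\deg(x)$ is the number of neighbors of $x$. For finite $\mathscr{W}\subseteq\mathscr{V}$, $g(\mathscr{W}):=\sum_{x\in\mathscr{W}}g(x)$, $|\mathscr{E}_{\mathscr{W}}|:=\frac12|\{(x,y)\in\mathscr{W}\times\mathscr{W}:x\sim y\}|$, and $\partial\mathscr{W}:=\{(x,y)\in\mathscr{W}\times(\mathscr{V}\setminus\mathscr{W}):x\sim y\}$. For $q\ge0$, $(\mathscr{G},q)$ is $(a,k)$-sparse if $2|\mathscr{E}_{\mathscr{W}}|\le k|\mathscr{W}|+a(|\partial\mathscr{W}|+q(\mathscr{W}))$ for every finite $\mathscr{W}\subseteq\mathscr{V}$; it is almost sparse if for every $\varepsilon>0$ there is $k_\varepsilon\ge0$ such that it is $(\varepsilon,k_\varepsilon)$-sparse. For $\mathscr{U}\subseteq\mathscr{V}$ the isoperimetric (Cheeger) constant is $$\alpha_{\mathscr{U}}:=\inf_{\emptyset\ne\mathscr{W}\subseteq\mathscr{U}\text{ finite}}\frac{|\partial\mathscr{W}|+q(\mathscr{W})}{\deg(\mathscr{W})+q(\mathscr{W})},$$ where the quotient is set to $0$ if $\deg(\mathscr{W})+q(\mathscr{W})=0$. The Cheeger constant at infinity is $\alpha_\infty:=\sup_{K\subseteq\mathscr{V}\text{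 finite}}\alpha_{\mathscr{V}\setminus K}\in[0,1]$. Finally $\liminf_{|x|\to\infty}g(x):=\sup_{\mathscr{W}\subset\mathscr{V}\text{ finite}}\inf_{x\in\mathscr{V}\setminus\mathscr{W}}g(x)$. *)

theory Defs
  imports Complex_Main "HOL-Library.Countable_Set" "HOL-Library.Extended_Real"
begin

(* The function E with values in {0,1} is rendered as a predicate; its values outside V are
   irrelevant, since every definition below only looks at pairs of vertices. *)
locale locally_finite_graph =
  fixes V :: "'v set" and E :: "'v \<Rightarrow> 'v \<Rightarrow> bool"
  assumes countable_vertices: "countable V"
    and symmetric: "\<And>x y. x \<in> V \<Longrightarrow> y \<in> V \<Longrightarrow> E x y \<longleftrightarrow> E y x"
    and zero_diagonal: "\<And>x. x \<in> V \<Longrightarrow> \<not> E x x"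
    and locally_finite: "\<And>x. x \<in> V \<Longrightarrow> finite {y \<in> V. E x y}"

definition vertex_degree :: "'v set \<Rightarrow> ('v \<Rightarrow> 'v \<Rightarrow> bool) \<Rightarrow> 'v \<Rightarrow> nat" where
  "vertex_degree V E x = card {y \<in> V. E x y}"

definition num_edges :: "('v \<Rightarrow> 'v \<Rightarrow> bool) \<Rightarrow> 'v set \<Rightarrow> real" where
  "num_edges E W = real (card {(x, y). x \<in> W \<and> y \<in> W \<and> E x y}) / 2"

definition edge_boundary :: "'v set \<Rightarrow> ('v \<Rightarrow> 'v \<Rightarrow> bool) \<Rightarrow> 'v set \<Rightarrow> ('v \<times> 'v) set" where
  "edge_boundary V E W = {(x, y). x \<in> W \<and> y \<in> V - W \<and> E x y}"

definition sparse ::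
    "'v set \<Rightarrow> ('v \<Rightarrow> 'v \<Rightarrow> bool) \<Rightarrow> ('v \<Rightarrow> real) \<Rightarrow> real \<Rightarrow> real \<Rightarrow> bool" where
  "sparse V E q a k \<longleftrightarrow>
     (\<forall>W. finite W \<and> W \<subseteq> V \<longrightarrow>
        2 * num_edges E W
          \<le> k * real (card W) + a * (real (card (edge_boundary V E W)) + (\<Sum>x\<in>W. q x)))"

definition almost_sparse :: "'v set \<Rightarrow> ('v \<Rightarrow> 'v \<Rightarrow> bool) \<Rightarrow> ('v \<Rightarrow> real) \<Rightarrow> bool" where
  "almost_sparse V E q \<longleftrightarrow> (\<forall>\<epsilon>>0. \<exists>k\<ge>0. sparse V E q \<epsilon> k)"

(* A quotient with vanishing denominator counts as 0, in agreement with x / 0 = 0 in HOL. *)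
definition cheeger_quotient ::
    "'v set \<Rightarrow> ('v \<Rightarrow> 'v \<Rightarrow> bool) \<Rightarrow> ('v \<Rightarrow> real) \<Rightarrow> 'v set \<Rightarrow> real" where
  "cheeger_quotient V E q W =
     (real (card (edge_boundary V E W)) + (\<Sum>x\<in>W. q x)) /
     ((\<Sum>x\<in>W. real (vertex_degree V E x)) + (\<Sum>x\<in>W. q x))"

(* Infima and suprema are taken in the complete lattice of extended reals; for infinite V the
   Cheeger constant at infinity lies in [0,1]. *)
definition cheeger ::
    "'v set \<Rightarrow> ('v \<Rightarrow> 'v \<Rightarrow> bool) \<Rightarrow> ('v \<Rightarrow> real) \<Rightarrow> 'v set \<Rightarrow> ereal" where
  "cheeger V E q U =
     (INF W \<in> {W. finite W \<and> W \<noteq> {} \<and> W \<subseteq> U}. ereal (cheeger_quotient V E q W))"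

definition cheeger_at_infinity ::
    "'v set \<Rightarrow> ('v \<Rightarrow> 'v \<Rightarrow> bool) \<Rightarrow> ('v \<Rightarrow> real) \<Rightarrow> ereal" where
  "cheeger_at_infinity V E q = (SUP K \<in> {K. finite K \<and> K \<subseteq> V}. cheeger V E q (V - K))"

definition liminf_at_infinity :: "'v set \<Rightarrow> ('v \<Rightarrow> real) \<Rightarrow> ereal" where
  "liminf_at_infinity V g = (SUP W \<in> {W. finite W \<and> W \<subseteq> V}. INF x \<in> V - W. ereal (g x))"

end

theory Submission
  imports Defs
begin

text \<open>
  Every edge leaving a vertex of a finite set \<open>W\<close> either stays in \<open>W\<close> or crosses its boundary,
  so \<open>deg(W) = 2|E_W| + |\<partial>W|\<close>. Hence a lower bound \<open>c\<close> on the Cheeger quotient of \<open>W\<close> is the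
  same as the inequality \<open>2|E_W| \<le> (1/c - 1)(|\<partial>W| + q(W))\<close>. If it only holds for sets avoiding a
  finite set \<open>K\<close>, restoring the vertices of \<open>K\<close> costs a bounded multiple of \<open>deg(K)\<close>, which is
  absorbed into \<open>k|W|\<close>. Conversely, where \<open>deg + q \<ge> t\<close> the term \<open>k|W|\<close> of a sparse graph is
  at most \<open>k/t\<close> times \<open>deg(W) + q(W)\<close>, which leaves a Cheeger quotient of at least
  \<open>(1 - k/t)/(1 + a)\<close>.
\<close>

context locally_finite_graph
begin

section \<open>Counting edges of finite vertex sets\<close>

abbreviation inner_edges :: "'v set \<Rightarrow> ('v \<times> 'v) set" where
  "inner_edges W \<equiv> {(x, y). x \<in> W \<and> y \<in> W \<and> E x y}"

abbreviation out_edges :: "'v set \<Rightarrow> ('v \<times> 'v) set" where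
  "out_edges W \<equiv> (SIGMA x:W. {y \<in> V. E x y})"

lemma finite_out_edges:
  assumes "finite W" "W \<subseteq> V"
  shows "finite (out_edges W)"
  using assms locally_finite by (intro finite_SigmaI) auto

lemma card_out_edges:
  assumes "finite W" "W \<subseteq> V"
  shows "card (out_edges W) = (\<Sum>x\<in>W. vertex_degree V E x)"
  unfolding vertex_degree_def using assms locally_finite by (intro card_SigmaI) auto

lemma out_edges_split:
  assumes "W \<subseteq> V"
  shows "out_edges W = inner_edges W \<union> edge_boundary V E W"
  using assms by (auto simp: edge_boundary_def)

text \<open>By symmetry the edges ending in \<open>W\<close> are the reversals of those starting
  there, so their number is also controlled by the degree sum of \<open>W\<close>.\<close>

lemma swap_out_edges:
  assumes "W \<subseteq> V"
  shows "prod.swap ` out_edges W = {(x, y). x \<in> V \<and> y \<in> W \<and> E x y}"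
  using assms symmetric by (fastforce simp: image_iff)

lemma finite_edge_boundary:
  assumes "finite W" "W \<subseteq> V"
  shows "finite (edge_boundary V E W)"
  using finite_out_edges[OF assms] out_edges_split[OF assms(2)] by simp

lemma finite_inner_edges:
  assumes "finite W" "W \<subseteq> V"
  shows "finite (inner_edges W)"
  using finite_out_edges[OF assms] out_edges_split[OF assms(2)] by simp

lemma degree_sum_eq:
  assumes "finite W" "W \<subseteq> V"
  shows "(\<Sum>x\<in>W. real (vertex_degree V E x)) =
    2 * num_edges E W + real (card (edge_boundary V E W))"
proof -
  have "card (out_edges W) = card (inner_edges W) + card (edge_boundary V E W)"
    unfolding out_edges_split[OF assms(2)]
    using finite_inner_edges[OF assms] finite_edge_boundary[OF assms]
    by (intro card_Un_disjoint) (auto simp: edge_boundary_def)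
  then show ?thesis
    using card_out_edges[OF assms] by (simp add: num_edges_def flip: of_nat_sum)
qed

text \<open>An ordered edge lost when \<open>K\<close> is removed starts or ends in
  \<open>W \<inter> K\<close>; either kind is bounded by the degree sum there, hence the factor
  2.\<close>

lemma num_edges_Diff:
  assumes "finite W" "W \<subseteq> V"
  shows "2 * num_edges E W \<le>
    2 * num_edges E (W - K) + 2 * (\<Sum>x\<in>W \<inter> K. real (vertex_degree V E x))"
proof -
  have WK: "finite (W \<inter> K)" "W \<inter> K \<subseteq> V" and D: "finite (W - K)" "W - K \<subseteq> V"
    using assms by auto
  note fin = finite_out_edges[OF WK] finite_inner_edges[OF D]
  have "inner_edges W \<subseteq>
      inner_edges (W - K) \<union> (out_edges (W \<inter> K) \<union> prod.swap ` out_edges (W \<inter> K))"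
    unfolding swap_out_edges[OF WK(2)] using assms by auto
  then have "card (inner_edges W) \<le>
      card (inner_edges (W - K) \<union> (out_edges (W \<inter> K) \<union> prod.swap ` out_edges (W \<inter> K)))"
    using fin by (intro card_mono) auto
  also have "\<dots> \<le> card (inner_edges (W - K)) +
      (card (out_edges (W \<inter> K)) + card (prod.swap ` out_edges (W \<inter> K)))"
    by (meson card_Un_le add_left_mono order_trans)
  also have "card (prod.swap ` out_edges (W \<inter> K)) \<le> card (out_edges (W \<inter> K))"
    using fin by (intro card_image_le)
  finally have "card (inner_edges W) \<le> card (inner_edges (W - K)) + 2 * card (out_edges (W \<inter> K))"
    by simp
  then have "real (card (inner_edges W)) \<le>
      real (card (inner_edges (W - K))) + 2 * real (card (out_edges (W \<inter> K)))"
    by linarith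
  then show ?thesis
    using card_out_edges[OF WK] by (simp add: num_edges_def)
qed

text \<open>A boundary edge of \<open>W - K\<close> either already leaves \<open>W\<close> or ends
  in \<open>W \<inter> K\<close>, and the latter kind is bounded by the degree sum there.\<close>

lemma card_edge_boundary_Diff:
  assumes "finite W" "W \<subseteq> V"
  shows "real (card (edge_boundary V E (W - K))) \<le>
    real (card (edge_boundary V E W)) + (\<Sum>x\<in>W \<inter> K. real (vertex_degree V E x))"
proof -
  have WK: "finite (W \<inter> K)" "W \<inter> K \<subseteq> V"
    using assms by auto
  note fin = finite_out_edges[OF WK] finite_edge_boundary[OF assms]
  have "edge_boundary V E (W - K) \<subseteq> edge_boundary V E W \<union> prod.swap ` out_edges (W \<inter> K)"
    unfolding swap_out_edges[OF WK(2)] using assms by (auto simp: edge_boundary_def)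
  then have "card (edge_boundary V E (W - K)) \<le>
      card (edge_boundary V E W \<union> prod.swap ` out_edges (W \<inter> K))"
    using fin by (intro card_mono) auto
  also have "\<dots> \<le> card (edge_boundary V E W) + card (prod.swap ` out_edges (W \<inter> K))"
    by (rule card_Un_le)
  also have "card (prod.swap ` out_edges (W \<inter> K)) \<le> card (out_edges (W \<inter> K))"
    using fin by (intro card_image_le)
  finally show ?thesis
    using card_out_edges[OF WK] by (simp flip: of_nat_sum of_nat_add)
qed

section \<open>From isoperimetry at infinity to sparseness\<close>

text \<open>Keeping the explicit constant \<open>1 / c - 1\<close> serves both forward directions:
  any admissible \<open>c < 1\<close> gives sparseness, while \<open>c\<close> close to 1 makes the
  constant arbitrarily small.\<close>

lemma sparse_if_less_cheeger_at_infinity: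
  assumes q: "\<And>x. x \<in> V \<Longrightarrow> 0 \<le> q x"
    and c: "0 < c" "c \<le> 1" "ereal c < cheeger_at_infinity V E q"
  shows "\<exists>k\<ge>0. sparse V E q (1 / c - 1) k"
proof -
  define a where "a = 1 / c - 1"
  have a: "0 \<le> a" using c by (simp add: a_def)
  obtain K where K: "finite K" "K \<subseteq> V" and cK: "ereal c < cheeger V E q (V - K)"
    using c(3) unfolding cheeger_at_infinity_def less_SUP_iff by blast
  define d where "d W = (\<Sum>x\<in>W. real (vertex_degree V E x))" for W
  have outside: "2 * num_edges E W \<le> a * (real (card (edge_boundary V E W)) + (\<Sum>x\<in>W. q x))"
    if W: "finite W" "W \<subseteq> V - K" for W
  proof (cases "W = {}")
    case True
    then show ?thesis by (simp add: num_edges_def edge_boundary_def)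
  next
    case False
    define b where "b = real (card (edge_boundary V E W)) + (\<Sum>x\<in>W. q x)"
    define D where "D = d W + (\<Sum>x\<in>W. q x)"
    have q0: "0 \<le> (\<Sum>x\<in>W. q x)" using W q by (intro sum_nonneg) auto
    have "cheeger V E q (V - K) \<le> ereal (cheeger_quotient V E q W)"
      unfolding cheeger_def using W False by (intro INF_lower) auto
    then have "c \<le> b / D"
      using cK by (simp add: cheeger_quotient_def b_def D_def d_def order.strict_implies_order
        flip: ereal_less_eq(3))
    moreover have "0 \<le> D" "0 \<le> b"
      using q0 by (auto simp: D_def d_def b_def intro!: sum_nonneg add_nonneg_nonneg)
    \<comment> \<open>\<open>D = 0\<close> cannot occur: the quotient would then be 0, contradicting
      \<open>0 < c\<close>.\<close>
    ultimately have "c * D \<le> b"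
      using c by (cases "D = 0") (auto simp: field_simps)
    then have "D \<le> b / c" using c by (simp add: field_simps)
    moreover have "D = 2 * num_edges E W + b"
      using degree_sum_eq[of W] W by (auto simp: D_def b_def d_def)
    ultimately have "2 * num_edges E W \<le> a * b" by (simp add: a_def algebra_simps)
    then show ?thesis by (simp only: b_def)
  qed
  \<comment> \<open>Removing \<open>K\<close> costs at most \<open>2 * d K\<close> in the edge count
    and \<open>a * d K\<close> through the new boundary edges, hence the factor
    \<open>a + 2\<close>.\<close>
  have "sparse V E q a ((a + 2) * d K)"
    unfolding sparse_def
  proof (intro allI impI, elim conjE)
    fix W assume W: "finite W" "W \<subseteq> V"
    define b where "b W = real (card (edge_boundary V E W))" for W
    show "2 * num_edges E W \<le> (a + 2) * d K * real (card W) +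
        a * (real (card (edge_boundary V E W)) + (\<Sum>x\<in>W. q x))"
    proof (cases "W = {}")
      case True
      then show ?thesis by (simp add: num_edges_def edge_boundary_def)
    next
      case False
      have dK: "0 \<le> d K" by (simp add: d_def sum_nonneg)
      have "2 * num_edges E W \<le> 2 * num_edges E (W - K) + 2 * d (W \<inter> K)"
        unfolding d_def by (rule num_edges_Diff[OF W])
      also have "2 * num_edges E (W - K) \<le> a * (b (W - K) + (\<Sum>x\<in>W - K. q x))"
        unfolding b_def using W by (intro outside) auto
      also have "\<dots> \<le> a * (b W + d (W \<inter> K) + (\<Sum>x\<in>W. q x))"
        using card_edge_boundary_Diff[OF W, of K] W q a
        by (intro mult_left_mono add_mono sum_mono2) (auto simp: b_def d_def)
      finally have "2 * num_edges E W \<le> (a + 2) * d (W \<inter> K) + a * (b W + (\<Sum>x\<in>W. q x))"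
        by (simp add: algebra_simps)
      moreover have "d (W \<inter> K) \<le> d K"
        unfolding d_def using K by (intro sum_mono2) auto
      then have "(a + 2) * d (W \<inter> K) \<le> (a + 2) * d K"
        using a by (intro mult_left_mono) auto
      \<comment> \<open>A nonempty \<open>W\<close> has at least one vertex, which turns the
        additive constant into a multiple of \<open>card W\<close>.\<close>
      moreover have "1 \<le> real (card W)"
        using W False by (simp add: Suc_le_eq card_gt_0_iff)
      then have "(a + 2) * d K * 1 \<le> (a + 2) * d K * real (card W)"
        using a dK by (intro mult_left_mono) auto
      ultimately show ?thesis unfolding b_def by linarith
    qed
  qed
  moreover have "0 \<le> (a + 2) * d K"
    using a by (simp add: d_def sum_nonneg)
  ultimately show ?thesis unfolding a_def by blast
qed

section \<open>From sparseness to isoperimetric bounds\<close>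

text \<open>Here \<open>s\<close> is the share of \<open>D\<close> that suffices to absorb
  \<open>k * card W\<close>. The finite and the infinite limit inferior are treated together; they
  differ only in how small \<open>s\<close> may be.\<close>

lemma cheeger_at_infinity_ge_if_sparse:
  assumes sp: "sparse V E q a k" and a: "0 < a" and k: "0 \<le> k" and s: "0 < s"
    and lim: "ereal (k / s) < liminf_at_infinity V (\<lambda>x. real (vertex_degree V E x) + q x)"
  shows "ereal ((1 - s) / (1 + a)) \<le> cheeger_at_infinity V E q"
proof -
  obtain K where K: "finite K" "K \<subseteq> V"
    and "ereal (k / s) < (INF x\<in>V - K. ereal (real (vertex_degree V E x) + q x))"
    using lim unfolding liminf_at_infinity_def less_SUP_iff by blast
  \<comment> \<open>The infimum is an extended real; a real \<open>t\<close> below it allows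
    ordinary arithmetic and still exceeds \<open>k / s\<close>.\<close>
  then obtain t where "ereal (k / s) < ereal t"
    and t: "ereal t < (INF x\<in>V - K. ereal (real (vertex_degree V E x) + q x))"
    using ereal_dense2 by blast
  then have kt: "k / s < t" by simp
  have t0: "0 < t" using kt k s by (meson divide_nonneg_pos le_less_trans)
  have "ereal ((1 - s) / (1 + a)) \<le> cheeger V E q (V - K)"
    unfolding cheeger_def
  proof (intro INF_greatest, clarify)
    fix W assume W: "finite W" "W \<noteq> {}" "W \<subseteq> V - K"
    define b where "b = real (card (edge_boundary V E W)) + (\<Sum>x\<in>W. q x)"
    define D where "D = (\<Sum>x\<in>W. real (vertex_degree V E x)) + (\<Sum>x\<in>W. q x)"
    have WV: "W \<subseteq> V" using W by auto
    have "t \<le> real (vertex_degree V E x) + q x" if "x \<in> W" for x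
    proof -
      have "(INF x\<in>V - K. ereal (real (vertex_degree V E x) + q x)) \<le>
          ereal (real (vertex_degree V E x) + q x)"
        using that W by (intro INF_lower) auto
      with t have "ereal t < ereal (real (vertex_degree V E x) + q x)"
        by (rule less_le_trans)
      then show ?thesis by simp
    qed
    then have tD: "real (card W) * t \<le> D"
      unfolding D_def sum.distrib[symmetric] by (rule sum_bounded_below)
    moreover have "0 < real (card W)" using W by (simp add: card_gt_0_iff)
    ultimately have D0: "0 < D" using t0 by (meson less_le_trans mult_pos_pos)
    have "k * real (card W) \<le> s * t * real (card W)"
      using kt s by (intro mult_right_mono) (auto simp: field_simps)
    also have "\<dots> \<le> s * D" using tD s by (simp add: mult_ac)
    finally have "k * real (card W) \<le> s * D" .
    moreover have "2 * num_edges E W \<le> k * real (card W) + a * b"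
      using sp W WV by (simp add: sparse_def b_def)
    moreover have "D = 2 * num_edges E W + b"
      using degree_sum_eq[OF W(1) WV] by (simp add: D_def b_def)
    ultimately have "(1 - s) * D \<le> (1 + a) * b" by (simp add: algebra_simps)
    then have "(1 - s) / (1 + a) \<le> b / D"
      using D0 a by (simp add: field_simps)
    then show "ereal ((1 - s) / (1 + a)) \<le> ereal (cheeger_quotient V E q W)"
      by (simp add: cheeger_quotient_def b_def D_def)
  qed
  also have "\<dots> \<le> cheeger_at_infinity V E q"
    unfolding cheeger_at_infinity_def using K by (intro SUP_upper) auto
  finally show ?thesis .
qed

text \<open>A singleton outside \<open>K\<close> has quotient at most 1. Infinitude of
  \<open>V\<close> provides one; over an empty family the infimum would be
  \<open>\<infinity>\<close>.\<close>

lemma cheeger_at_infinity_le_1: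
  assumes inf: "infinite V" and q: "\<And>x. x \<in> V \<Longrightarrow> 0 \<le> q x"
  shows "cheeger_at_infinity V E q \<le> 1"
  unfolding cheeger_at_infinity_def
proof (intro SUP_least, clarify)
  fix K assume "finite K" "K \<subseteq> V"
  then have "infinite (V - K)" using inf by simp
  then obtain x where x: "x \<in> V - K" using infinite_imp_nonempty by blast
  have "cheeger V E q (V - K) \<le> ereal (cheeger_quotient V E q {x})"
    unfolding cheeger_def using x by (intro INF_lower) auto
  also have "cheeger_quotient V E q {x} \<le> 1"
  proof -
    have "0 \<le> num_edges E {x}" by (simp add: num_edges_def)
    then show ?thesis
      using degree_sum_eq[of "{x}"] x q[of x] by (simp add: cheeger_quotient_def divide_le_eq)
  qed
  finally show "cheeger V E q (V - K) \<le> 1" by (simp add: one_ereal_def)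
qed

text \<open>The bound corresponds to \<open>s = k / l\<close>, which just fails the strict condition
  \<open>k / s < l\<close>. It is therefore approached from below.\<close>

lemma cheeger_at_infinity_ge_if_sparse_finite_liminf:
  assumes sp: "sparse V E q a k" and a: "0 < a" and k: "0 \<le> k" and kl: "k < l"
    and lim: "liminf_at_infinity V (\<lambda>x. real (vertex_degree V E x) + q x) = ereal l"
  shows "ereal ((l - k) / (l * (a + 1))) \<le> cheeger_at_infinity V E q"
proof (rule dense_le)
  fix z assume z: "z < ereal ((l - k) / (l * (a + 1)))"
  show "z \<le> cheeger_at_infinity V E q"
  proof (cases z)
    case (real c)
    \<comment> \<open>This \<open>s\<close> solves \<open>(1 - s) / (1 + a) = c\<close>, and
      \<open>c\<close> lying below the bound means exactly \<open>k < s * l\<close>.\<close>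
    define s where "s = 1 - c * (1 + a)"
    have "c < (l - k) / (l * (a + 1))" using z real by simp
    moreover have "0 < l * (a + 1)" using k kl a by simp
    ultimately have "c * (l * (a + 1)) < l - k" by (simp only: pos_less_divide_eq)
    then have ks: "k < s * l" by (simp add: s_def algebra_simps)
    then have s: "0 < s"
      using k kl by (meson le_less_trans zero_less_mult_pos2)
    have "k / s < l" using ks s by (simp add: field_simps)
    then have "ereal ((1 - s) / (1 + a)) \<le> cheeger_at_infinity V E q"
      using lim by (intro cheeger_at_infinity_ge_if_sparse[OF sp a k s]) simp
    then show ?thesis using a real by (simp add: s_def)
  qed (use z in auto)
qed

text \<open>Now every \<open>s > 0\<close> is admissible, and the bound is the limit of
  \<open>(1 - s) / (1 + a)\<close> as \<open>s\<close> tends to 0.\<close>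

lemma cheeger_at_infinity_ge_if_sparse_infinite_liminf:
  assumes sp: "sparse V E q a k" and a: "0 < a" and k: "0 \<le> k"
    and lim: "liminf_at_infinity V (\<lambda>x. real (vertex_degree V E x) + q x) = \<infinity>"
  shows "ereal (1 / (1 + a)) \<le> cheeger_at_infinity V E q"
proof (rule dense_le)
  fix z assume z: "z < ereal (1 / (1 + a))"
  show "z \<le> cheeger_at_infinity V E q"
  proof (cases z)
    case (real c)
    define s where "s = 1 - c * (1 + a)"
    have s: "0 < s" using z real a by (simp add: s_def field_simps)
    have "ereal ((1 - s) / (1 + a)) \<le> cheeger_at_infinity V E q"
      using lim by (intro cheeger_at_infinity_ge_if_sparse[OF sp a k s]) simp
    then show ?thesis using a real by (simp add: s_def)
  qed (use z in auto)
qed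

section \<open>Almost sparseness and the qualitative statements\<close>

lemma almost_sparse_if_cheeger_at_infinity_eq_1:
  assumes "\<And>x. x \<in> V \<Longrightarrow> 0 \<le> q x" and "cheeger_at_infinity V E q = 1"
  shows "almost_sparse V E q"
  unfolding almost_sparse_def
proof (intro allI impI)
  fix \<epsilon> :: real assume \<epsilon>: "0 < \<epsilon>"
  \<comment> \<open>The choice \<open>c = 1 / (1 + \<epsilon>)\<close>, which is below 1, turns
    \<open>1 / c - 1\<close> into \<open>\<epsilon>\<close>.\<close>
  have "\<exists>k\<ge>0. sparse V E q (1 / (1 / (1 + \<epsilon>)) - 1) k"
    using assms \<epsilon> by (intro sparse_if_less_cheeger_at_infinity) auto
  then show "\<exists>k\<ge>0. sparse V E q \<epsilon> k" by simp
qed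

lemma cheeger_at_infinity_eq_1_if_almost_sparse:
  assumes "infinite V" and "\<And>x. x \<in> V \<Longrightarrow> 0 \<le> q x"
    and sp: "almost_sparse V E q"
    and lim: "liminf_at_infinity V (\<lambda>x. real (vertex_degree V E x) + q x) = \<infinity>"
  shows "cheeger_at_infinity V E q = 1"
proof (rule antisym)
  show "cheeger_at_infinity V E q \<le> 1"
    using assms by (intro cheeger_at_infinity_le_1)
  show "1 \<le> cheeger_at_infinity V E q"
  proof (rule dense_le)
    fix z :: ereal assume z: "z < 1"
    \<comment> \<open>The maximum with 0 keeps \<open>c\<close> positive, so that
      \<open>a = 1 / c - 1\<close> is defined and positive; for this \<open>a\<close> the bound
      \<open>1 / (1 + a)\<close> is \<open>c\<close> itself.\<close>
    then have "max z 0 < 1" by simp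
    then obtain c where c: "max z 0 < ereal c" "ereal c < 1"
      using ereal_dense2 by blast
    then have c01: "0 < c" "c < 1" and zc: "z < ereal c" by auto
    have a: "0 < 1 / c - 1" using c01 by simp
    then obtain k where "0 \<le> k" "sparse V E q (1 / c - 1) k"
      using sp unfolding almost_sparse_def by blast
    then have "ereal (1 / (1 + (1 / c - 1))) \<le> cheeger_at_infinity V E q"
      using a lim by (intro cheeger_at_infinity_ge_if_sparse_infinite_liminf)
    then show "z \<le> cheeger_at_infinity V E q"
      using zc by (simp add: order.strict_implies_order order.strict_trans2)
  qed
qed

lemma sparse_if_cheeger_at_infinity_pos:
  assumes q: "\<And>x. x \<in> V \<Longrightarrow> 0 \<le> q x" and pos: "0 < cheeger_at_infinity V E q"
  shows "\<exists>a>0. \<exists>k\<ge>0. sparse V E q a k"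
proof -
  \<comment> \<open>The minimum with 1 forces \<open>c < 1\<close>, which makes the sparseness
    constant \<open>1 / c - 1\<close> strictly positive.\<close>
  have "0 < min (cheeger_at_infinity V E q) 1" using pos by simp
  then obtain c where c: "0 < ereal c" "ereal c < min (cheeger_at_infinity V E q) 1"
    using ereal_dense2 by blast
  then have c01: "0 < c" "c < 1" "ereal c < cheeger_at_infinity V E q" by auto
  then have "\<exists>k\<ge>0. sparse V E q (1 / c - 1) k"
    using q by (intro sparse_if_less_cheeger_at_infinity) auto
  moreover have "0 < 1 / c - 1" using c01 by simp
  ultimately show ?thesis by blast
qed

end

theorem theorem5p5:
  fixes V :: "'v set" and E :: "'v \<Rightarrow> 'v \<Rightarrow> bool" and q :: "'v \<Rightarrow> real"
  assumes "locally_finite_graph V E"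
    and "infinite V"
    and "\<And>x. x \<in> V \<Longrightarrow> 0 \<le> q x"
  shows
    "((cheeger_at_infinity V E q > 0 \<longrightarrow> (\<exists>a>0. \<exists>k\<ge>0. sparse V E q a k)) \<and>
      (\<forall>a>0. \<forall>k\<ge>0.
         sparse V E q a k \<and>
         liminf_at_infinity V (\<lambda>x. real (vertex_degree V E x) + q x) > ereal k \<longrightarrow>
           (\<forall>l::real. liminf_at_infinity V (\<lambda>x. real (vertex_degree V E x) + q x) = ereal l \<longrightarrow>
              cheeger_at_infinity V E q \<ge> ereal ((l - k) / (l * (a + 1))) \<and>
              (l - k) / (l * (a + 1)) > 0) \<and>
           (liminf_at_infinity V (\<lambda>x. real (vertex_degree V E x) + q x) = \<infinity> \<longrightarrow>
              cheeger_at_infinity V E q \<ge> ereal (1 / (1 + a))))) \<and>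
     ((cheeger_at_infinity V E q = 1 \<longrightarrow> almost_sparse V E q) \<and>
      (almost_sparse V E q \<and>
       liminf_at_infinity V (\<lambda>x. real (vertex_degree V E x) + q x) = \<infinity> \<longrightarrow>
         cheeger_at_infinity V E q = 1))"
proof -
  interpret locally_finite_graph V E by fact
  let ?L = "liminf_at_infinity V (\<lambda>x. real (vertex_degree V E x) + q x)"
  have 1: "0 < cheeger_at_infinity V E q \<longrightarrow> (\<exists>a>0. \<exists>k\<ge>0. sparse V E q a k)"
    using sparse_if_cheeger_at_infinity_pos[of q, OF assms(3)] by blast
  have 2: "ereal ((l - k) / (l * (a + 1))) \<le> cheeger_at_infinity V E q \<and>
      0 < (l - k) / (l * (a + 1))"
    if "0 < a" "0 \<le> k" "sparse V E q a k" "ereal k < ?L" "?L = ereal l" for a k l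
  proof
    have "k < l" using that(4,5) by simp
    with that show "ereal ((l - k) / (l * (a + 1))) \<le> cheeger_at_infinity V E q"
      by (intro cheeger_at_infinity_ge_if_sparse_finite_liminf)
    show "0 < (l - k) / (l * (a + 1))" using that(1,2) \<open>k < l\<close> by simp
  qed
  have 3: "ereal (1 / (1 + a)) \<le> cheeger_at_infinity V E q"
    if "0 < a" "0 \<le> k" "sparse V E q a k" "?L = \<infinity>" for a k
    using that by (intro cheeger_at_infinity_ge_if_sparse_infinite_liminf)
  have 4: "cheeger_at_infinity V E q = 1 \<longrightarrow> almost_sparse V E q"
    using almost_sparse_if_cheeger_at_infinity_eq_1[of q, OF assms(3)] by blast
  have 5: "almost_sparse V E q \<and> ?L = \<infinity> \<longrightarrow> cheeger_at_infinity V E q = 1"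
    using cheeger_at_infinity_eq_1_if_almost_sparse[of q, OF assms(2,3)] by blast
  show ?thesis using 1 2 3 4 5 by blast
qed

end
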